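(* Suppose that $A$ is a countable torsion-free abelian group with $\operatorname{rank}(A)>1$. Then $LO(A)$ is homeomorphic to the Cantor set, and the set $Z$ of (positive cones of) all dense left orderings of $A$ is a dense $G_\delta$ set within $LO(A)$.
   Context: A left ordering of a group $G$ is a strict total ordering $<$ of $G$ such that $g<h$ implies $fg<fh$ for all $f,g,h\in G$. Its positive cone is $P=\{g\in G: g>1\}$. Positive cones are exactly the subsets $P\subset G$ with $PP\subset P$ such that for every $g\in G$ exactly one of $g\in P$, $g^{-1}\in P$, $g=1$ holds; the associated ordering is $g<h$ iff $g^{-1}h\in P$. $LO(G)\subset 2^G$ is the set of all positive cones of $G$, with the subspace topology from the product topology on $2^G$; a subbasis is given by the sets $U_g=\{P\in LO(G): g\in P\}$, $g\in G$. A left ordering is dense if whenever $g<h$ there exists $f\in G$ with $g<f<h$. A $G_\delta$ set is a countable intersection of open sets. The rank of a torsion-free abelian group $A$ is $\dim_{\mathbb{Q}}(A\otimes\mathbb{Q})$. *)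

theory Defs
  imports "HOL-Analysis.Analysis" "HOL-Library.Poly_Mapping" "HOL-Library.Extended_Nat"
begin

text \<open>
  Groups are types of class \<^class>\<open>group_add\<close>, which is not assumed commutative; the group
  operation is written additively, so that \<open>0\<close> is the identity and \<open>- g\<close> the inverse of \<open>g\<close>.
\<close>

section \<open>Left orderings and their positive cones\<close>

definition left_ordering :: "('a::group_add \<Rightarrow> 'a \<Rightarrow> bool) \<Rightarrow> bool" where
  "left_ordering lt \<longleftrightarrow>
     irreflp lt \<and> transp lt \<and> totalp lt \<and> (\<forall>f g h. lt g h \<longrightarrow> lt (f + g) (f + h))"

definition positive_cone :: "('a::group_add \<Rightarrow> 'a \<Rightarrow> bool) \<Rightarrow> 'a set" where
  "positive_cone lt = {g. lt 0 g}"

definition dense_ordering :: "('a \<Rightarrow> 'a \<Rightarrow> bool) \<Rightarrow> bool" where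
  "dense_ordering lt \<longleftrightarrow> (\<forall>g h. lt g h \<longrightarrow> (\<exists>f. lt g f \<and> lt f h))"

definition LO :: "'a::group_add set set" where
  "LO = {positive_cone lt | lt. left_ordering lt}"

definition dense_LO :: "'a::group_add set set" where
  "dense_LO = {positive_cone lt | lt. left_ordering lt \<and> dense_ordering lt}"

text \<open>
  The subspace topology on \<open>LO\<close>: a subset of the group is identified with its characteristic
  function, a point of the product of copies of the discrete two-point space \<^typ>\<open>bool\<close>.
\<close>

definition LO_topology :: "'a::group_add set topology" where
  "LO_topology =
     pullback_topology LO (\<lambda>P g. g \<in> P) (product_topology (\<lambda>_. discrete_topology UNIV) UNIV)"

lemma less_iff_in_positive_cone:
  assumes "left_ordering lt"
  shows "lt g h \<longleftrightarrow> - g + h \<in> positive_cone lt"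
proof -
  have "lt (f + x) (f + y)" if "lt x y" for f x y
    using assms that by (auto simp: left_ordering_def)
  from this[of g h "- g"] this[of 0 "- g + h" g] show ?thesis
    by (auto simp: positive_cone_def)
qed

lemma LO_iff:
  "P \<in> LO \<longleftrightarrow> (\<forall>g\<in>P. \<forall>h\<in>P. g + h \<in> P) \<and>
     (\<forall>g. (g \<in> P \<and> - g \<notin> P \<and> g \<noteq> 0) \<or> (g \<notin> P \<and> - g \<in> P \<and> g \<noteq> 0) \<or>
          (g \<notin> P \<and> - g \<notin> P \<and> g = 0))" (is "_ \<longleftrightarrow> ?R P")
proof
  assume "P \<in> LO"
  then obtain lt where lt: "left_ordering lt" and P: "P = positive_cone lt"
    by (auto simp: LO_def)
  have ir: "\<not> lt x x" and tr: "lt x y \<Longrightarrow> lt y z \<Longrightarrow> lt x z" and tot: "x \<noteq> y \<Longrightarrow> lt x y \<or> lt y x"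
    and inv: "lt x y \<Longrightarrow> lt (f + x) (f + y)" for x y z f
    using lt by (auto simp: left_ordering_def irreflp_def totalp_on_def dest: transpD)
  have mem: "g \<in> P \<longleftrightarrow> lt 0 g" for g
    by (simp add: P positive_cone_def)
  have neg: "lt 0 (- g) \<longleftrightarrow> lt g 0" for g
    using inv[of 0 "- g" g] inv[of g 0 "- g"] by auto
  have "g + h \<in> P" if "g \<in> P" "h \<in> P" for g h
    using that inv[of 0 h g] tr[of 0 g "g + h"] by (auto simp: mem)
  then show "?R P"
    unfolding mem neg
  proof (intro conjI ballI allI)
    fix g
    show "lt 0 g \<and> \<not> lt g 0 \<and> g \<noteq> 0 \<or> \<not> lt 0 g \<and> lt g 0 \<and> g \<noteq> 0 \<or>
      \<not> lt 0 g \<and> \<not> lt g 0 \<and> g = 0"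
      using ir[of 0] tr[of 0 g 0] tot[of 0 g] by (cases "g = 0") auto
  qed (simp add: mem)
next
  assume R: "?R P"
  define lt where "lt = (\<lambda>g h. - g + h \<in> P)"
  have "irreflp lt"
    using R by (auto simp: irreflp_def lt_def)
  moreover have "transp lt"
  proof (rule transpI)
    fix x y z assume "lt x y" "lt y z"
    then have "(- x + y) + (- y + z) \<in> P"
      using R by (auto simp: lt_def)
    then show "lt x z"
      by (simp add: lt_def add.assoc)
  qed
  moreover have "totalp lt"
  proof (rule totalpI)
    fix x y :: 'a assume "x \<noteq> y"
    then have "- x + y \<noteq> 0"
      by (metis add.right_neutral add_minus_cancel)
    then have "- x + y \<in> P \<or> - (- x + y) \<in> P"
      using R[THEN conjunct2, rule_format, of "- x + y"] by auto
    then show "lt x y \<or> lt y x"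
      by (simp add: lt_def minus_add)
  qed
  moreover have "lt (f + g) (f + h)" if "lt g h" for f g h
    using that by (simp add: lt_def minus_add flip: add.assoc)
  ultimately have "left_ordering lt"
    by (auto simp: left_ordering_def)
  moreover have "P = positive_cone lt"
    by (auto simp: positive_cone_def lt_def)
  ultimately show "P \<in> LO"
    by (auto simp: LO_def)
qed

lemma topspace_LO_topology [simp]: "topspace LO_topology = LO"
  by (auto simp: LO_topology_def topspace_pullback_topology)

section \<open>The Cantor set\<close>

primrec cantor_approx :: "nat \<Rightarrow> real set" where
  "cantor_approx 0 = {0..1}"
| "cantor_approx (Suc n) =
     (\<lambda>x. x / 3) ` cantor_approx n \<union> (\<lambda>x. (x + 2) / 3) ` cantor_approx n"

definition cantor_set :: "real set" where
  "cantor_set = (\<Inter>n. cantor_approx n)"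

section \<open>Torsion-free abelian groups and their rank\<close>

text \<open>\<open>\<Sum>i<n. a\<close> is the \<open>n\<close>-fold sum of \<open>a\<close>.\<close>

definition torsion_free :: "'a::ab_group_add itself \<Rightarrow> bool" where
  "torsion_free _ \<longleftrightarrow> (\<forall>(a::'a) n::nat. 0 < n \<longrightarrow> (\<Sum>i<n. a) = 0 \<longrightarrow> a = 0)"

text \<open>
  The tensor product over the integers is the free abelian group \<^typ>\<open>('a \<times> 'b) \<Rightarrow>\<^sub>0 int\<close> on the
  pairs, modulo the subgroup generated by the biadditivity relations.
\<close>

inductive_set tensor_rel :: "(('a::ab_group_add \<times> 'b::ab_group_add) \<Rightarrow>\<^sub>0 int) set" where
  zero: "0 \<in> tensor_rel"
| add_left: "frag_of (a + a', b) - frag_of (a, b) - frag_of (a', b) \<in> tensor_rel"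
| add_right: "frag_of (a, b + b') - frag_of (a, b) - frag_of (a, b') \<in> tensor_rel"
| diff: "x \<in> tensor_rel \<Longrightarrow> y \<in> tensor_rel \<Longrightarrow> x - y \<in> tensor_rel"

lemma tensor_rel_uminus: "x \<in> tensor_rel \<Longrightarrow> - x \<in> tensor_rel"
  using tensor_rel.diff[OF tensor_rel.zero] by fastforce

lemma tensor_rel_add: "x \<in> tensor_rel \<Longrightarrow> y \<in> tensor_rel \<Longrightarrow> x + y \<in> tensor_rel"
  using tensor_rel.diff[OF _ tensor_rel_uminus] by fastforce

quotient_type (overloaded) ('a, 'b) tensor =
  "('a::ab_group_add \<times> 'b::ab_group_add) \<Rightarrow>\<^sub>0 int" / "\<lambda>x y. x - y \<in> tensor_rel"
proof (rule equivpI)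
  show "reflp (\<lambda>x y. x - y \<in> (tensor_rel :: (('a \<times> 'b) \<Rightarrow>\<^sub>0 int) set))"
    by (rule reflpI) (simp add: tensor_rel.zero)
  show "symp (\<lambda>x y. x - y \<in> (tensor_rel :: (('a \<times> 'b) \<Rightarrow>\<^sub>0 int) set))"
    by (rule sympI) (metis tensor_rel_uminus minus_diff_eq)
  show "transp (\<lambda>x y. x - y \<in> (tensor_rel :: (('a \<times> 'b) \<Rightarrow>\<^sub>0 int) set))"
  proof (rule transpI)
    fix x y z :: "('a \<times> 'b) \<Rightarrow>\<^sub>0 int"
    assume "x - y \<in> tensor_rel" "y - z \<in> tensor_rel"
    from tensor_rel_add[OF this] show "x - z \<in> tensor_rel"
      by simp
  qed
qed

instantiation tensor :: (ab_group_add, ab_group_add) ab_group_add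
begin

lift_definition zero_tensor :: "('a, 'b) tensor" is 0 .

lift_definition plus_tensor :: "('a, 'b) tensor \<Rightarrow> ('a, 'b) tensor \<Rightarrow> ('a, 'b) tensor" is "(+)"
  by (simp only: add_diff_add tensor_rel_add)

lift_definition uminus_tensor :: "('a, 'b) tensor \<Rightarrow> ('a, 'b) tensor" is uminus
  by (simp only: minus_diff_minus tensor_rel_uminus)

lift_definition minus_tensor :: "('a, 'b) tensor \<Rightarrow> ('a, 'b) tensor \<Rightarrow> ('a, 'b) tensor" is "(-)"
  subgoal premises prems using tensor_rel.diff[OF prems] by (simp add: algebra_simps)
  done

instance
  by standard (transfer; simp add: tensor_rel.zero algebra_simps)+

end

lift_definition tensor_of :: "'a::ab_group_add \<Rightarrow> 'b::ab_group_add \<Rightarrow> ('a, 'b) tensor"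
  is "\<lambda>a b. frag_of (a, b)" .

lemma tensor_of_add_left: "tensor_of (a + a') b = tensor_of a b + tensor_of a' b"
  by transfer (simp only: diff_diff_add[symmetric] tensor_rel.add_left)

lemma tensor_of_add_right: "tensor_of a (b + b') = tensor_of a b + tensor_of a b'"
  by transfer (simp only: diff_diff_add[symmetric] tensor_rel.add_right)

lemma tensor_induct [case_names zero tensor_of diff]:
  assumes "P 0" and "\<And>a b. P (tensor_of a b)" and "\<And>x y. P x \<Longrightarrow> P y \<Longrightarrow> P (x - y)"
  shows "P t"
  using assms
proof transfer
  fix P :: "(('a \<times> 'b) \<Rightarrow>\<^sub>0 int) \<Rightarrow> bool" and t
  assume "P 0" "\<And>a b. P (frag_of (a, b))" "\<And>x y. P x \<Longrightarrow> P y \<Longrightarrow> P (x - y)"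
  then show "P t"
    using frag_induction[of t UNIV P] by force
qed

text \<open>The rational vector space structure on \<open>A \<otimes> \<rat>\<close>: \<open>q \<cdot> (a \<otimes> r) = a \<otimes> (q r)\<close>.\<close>

lift_definition rat_scale :: "rat \<Rightarrow> ('a::ab_group_add, rat) tensor \<Rightarrow> ('a, rat) tensor"
  is "\<lambda>q. frag_extend (\<lambda>(a, r). frag_of (a, q * r))"
proof -
  fix q :: rat and x y :: "('a \<times> rat) \<Rightarrow>\<^sub>0 int"
  let ?f = "frag_extend (\<lambda>(a, r). frag_of (a, q * r)) :: _ \<Rightarrow> ('a \<times> rat) \<Rightarrow>\<^sub>0 int"
  have "?f z \<in> tensor_rel" if "z \<in> tensor_rel" for z
    using that
    by induction (auto simp: frag_extend_diff distrib_left intro: tensor_rel.intros)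
  then show "x - y \<in> tensor_rel \<Longrightarrow> ?f x - ?f y \<in> tensor_rel"
    by (simp flip: frag_extend_diff)
qed

lemma rat_scale_tensor_of [simp]: "rat_scale q (tensor_of a r) = tensor_of a (q * r)"
  by transfer (simp add: tensor_rel.zero)

lemma rat_scale_zero [simp]: "rat_scale q 0 = 0"
  by transfer (simp add: tensor_rel.zero)

lemma rat_scale_diff: "rat_scale q (x - y) = rat_scale q x - rat_scale q y"
  by transfer (simp add: tensor_rel.zero frag_extend_diff)

global_interpretation rat_tensor: vector_space rat_scale
proof
  fix p q :: rat and x y :: "('a, rat) tensor"
  show "rat_scale p (x + y) = rat_scale p x + rat_scale p y"
    by transfer (simp add: tensor_rel.zero frag_extend_add)
  show "rat_scale (p + q) x = rat_scale p x + rat_scale q x"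
    by (induction x rule: tensor_induct)
       (auto simp: rat_scale_diff distrib_right tensor_of_add_right)
  show "rat_scale p (rat_scale q x) = rat_scale (p * q) x"
    by (induction x rule: tensor_induct) (auto simp: rat_scale_diff mult.assoc)
  show "rat_scale 1 x = x"
    by (induction x rule: tensor_induct) (auto simp: rat_scale_diff)
qed

text \<open>
  The dimension \<^const>\<open>rat_tensor.dim\<close> is a natural number with the junk value \<open>0\<close> for
  infinite-dimensional spaces, which are therefore treated separately.
\<close>

definition abelian_rank :: "'a::ab_group_add itself \<Rightarrow> enat" where
  "abelian_rank _ =
     (if \<exists>B :: ('a, rat) tensor set. finite B \<and> rat_tensor.span B = UNIV
      then enat (rat_tensor.dim (UNIV :: ('a, rat) tensor set)) else \<infinity>)"

end

theory Submission
  imports Defs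
begin

text \<open>
  A basic open set of \<open>LO\<close> consists of the positive cones that contain a given finite set \<open>F\<close>.
  Everything rests on one algebraic fact (\<open>exists_indeterminate_element\<close>): finitely many positivity
  conditions never decide the sign of every element, unless the rank is at most one. Indeed, let
  \<open>F\<close> be a minimal finite set of positive elements whose consequences decide all signs. If \<open>f \<noteq> g\<close>
  are in \<open>F\<close>, say with \<open>f - g\<close> positive, then \<open>f - g\<close> is, up to multiples, a sum of elements of
  \<open>F\<close>; solving for \<open>f\<close> shows that \<open>f\<close> already follows from \<open>F - {f}\<close>, against minimality.
  So \<open>F\<close> has at most one element, and the whole group is commensurable with it.

  Conversely, a set of nonzero elements can be made positive as soon as the cone that it generates contains
  no pair \<open>x, - x\<close> with \<open>x \<noteq> 0\<close> (\<open>pointed_extends_to_LO\<close>, by Zorn's lemma). Let \<open>k\<close> be an element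
  whose sign is not decided by \<open>F\<close>.

  \<^item> Both \<open>F \<union> {k}\<close> and \<open>F \<union> {- k}\<close> extend to positive cones, so \<open>LO\<close> has no isolated points. For
    a countable group, \<open>LO\<close> is a nonempty compact space whose points are separated by countably many clopen
    sets, and these properties characterise the Cantor set
    (\<open>perfect_clopen_separated_homeomorphic_cantor_set\<close>).

  \<^item> If \<open>g \<in> F\<close>, then \<open>F \<union> {g + k, g - k}\<close> extends to a positive cone. There one of \<open>k\<close>, \<open>- k\<close> is
    a positive element below \<open>g\<close>, so \<open>g\<close> is not the least positive element. Hence the open set
    \<open>not_least g\<close> is dense for each \<open>g\<close>. An ordering is dense precisely when it has no least positive
    element, so \<open>dense_LO\<close> is the intersection of these countably many dense open sets, and the
    Baire category theorem applies.
\<close>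

section \<open>Isolated cones in abelian groups\<close>

abbreviation nat_mult :: "nat \<Rightarrow> 'a \<Rightarrow> 'a::ab_group_add" (infixr \<open>\<cdot>\<close> 75) where
  "n \<cdot> x \<equiv> \<Sum>i<n. x"

lemma nat_mult_add_left: "(m + n) \<cdot> x = m \<cdot> x + n \<cdot> x" for x :: "'a::ab_group_add"
  by (induction m) (simp_all add: algebra_simps)

lemma nat_mult_mult: "(m * n) \<cdot> x = m \<cdot> n \<cdot> x" for x :: "'a::ab_group_add"
  by (induction m) (simp_all add: nat_mult_add_left algebra_simps)

lemma nat_mult_commute: "m \<cdot> n \<cdot> x = n \<cdot> m \<cdot> x" for x :: "'a::ab_group_add"
  by (metis mult.commute nat_mult_mult)

lemma nat_mult_uminus: "n \<cdot> (- x) = - (n \<cdot> x)" for x :: "'a::ab_group_add"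
  by (rule sum_negf)

text \<open>
  Closing under roots makes this the preimage of the rational convex cone that \<open>F\<close> spans in
  \<open>A \<otimes> \<rat>\<close>, so that rational cones are available without leaving the group. Since a root of a
  positive element is positive in any ordering, positivity of \<open>F\<close> extends to its nonzero elements
  (\<open>isolated_cone_subset_LO\<close>).
\<close>

inductive_set isolated_cone :: "'a::ab_group_add set \<Rightarrow> 'a set" for F where
  zero: "0 \<in> isolated_cone F"
| incl: "f \<in> F \<Longrightarrow> f \<in> isolated_cone F"
| add: "x \<in> isolated_cone F \<Longrightarrow> y \<in> isolated_cone F \<Longrightarrow> x + y \<in> isolated_cone F"
| root: "n \<cdot> x \<in> isolated_cone F \<Longrightarrow> 0 < n \<Longrightarrow> x \<in> isolated_cone F"

lemma isolated_cone_minimal: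
  assumes "F \<subseteq> isolated_cone G"
  shows "isolated_cone F \<subseteq> isolated_cone G"
proof
  fix x assume "x \<in> isolated_cone F"
  then show "x \<in> isolated_cone G"
    by induction (use assms in \<open>auto intro: isolated_cone.intros\<close>)
qed

lemma isolated_cone_mono: "F \<subseteq> G \<Longrightarrow> isolated_cone F \<subseteq> isolated_cone G"
  by (rule isolated_cone_minimal) (auto intro: isolated_cone.incl)

lemma isolated_cone_nat_mult: "x \<in> isolated_cone F \<Longrightarrow> n \<cdot> x \<in> isolated_cone F"
  by (induction n) (auto intro: isolated_cone.intros)

text \<open>
  Coefficients of a single generator can be isolated after clearing denominators. All computations
  with cones below solve such an equation for \<open>f\<close> or for \<open>x\<close>.
\<close>

lemma isolated_cone_insertE:
  assumes "x \<in> isolated_cone (insert f F)"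
  obtains n m c where "0 < n" "c \<in> isolated_cone F" "n \<cdot> x = m \<cdot> f + c"
proof -
  from assms have "\<exists>n m. \<exists>c\<in>isolated_cone F. 0 < n \<and> n \<cdot> x = m \<cdot> f + c"
  proof induction
    case zero
    have "1 \<cdot> 0 = 0 \<cdot> f + 0" by simp
    then show ?case by (blast intro: isolated_cone.zero zero_less_one)
  next
    case (incl g)
    have "1 \<cdot> f = 1 \<cdot> f + 0" "1 \<cdot> g = 0 \<cdot> f + g" by simp_all
    with incl show ?case
      by (metis insert_iff isolated_cone.incl isolated_cone.zero zero_less_one)
  next
    case (add x y)
    then obtain n m c n' m' c' where
      x: "c \<in> isolated_cone F" "0 < n" "n \<cdot> x = m \<cdot> f + c" and
      y: "c' \<in> isolated_cone F" "0 < n'" "n' \<cdot> y = m' \<cdot> f + c'"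
      by blast
    have "(n * n') \<cdot> (x + y) = n' \<cdot> n \<cdot> x + n \<cdot> n' \<cdot> y"
      by (simp add: sum.distrib nat_mult_mult nat_mult_commute[where m = n and n = n'])
    also have "\<dots> = (n' * m + n * m') \<cdot> f + (n' \<cdot> c + n \<cdot> c')"
      unfolding x y by (simp add: sum.distrib nat_mult_mult nat_mult_add_left)
    finally have "(n * n') \<cdot> (x + y) = (n' * m + n * m') \<cdot> f + (n' \<cdot> c + n \<cdot> c')" .
    moreover have "n' \<cdot> c + n \<cdot> c' \<in> isolated_cone F"
      using x y by (intro isolated_cone.add isolated_cone_nat_mult)
    ultimately show ?case
      using x(2) y(2) by (metis nat_0_less_mult_iff)
  next
    case (root n x)
    then obtain n' m c where "c \<in> isolated_cone F" "0 < n'" "n' \<cdot> n \<cdot> x = m \<cdot> f + c"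
      by blast
    with root(2) show ?case
      by (metis nat_0_less_mult_iff nat_mult_mult)
  qed
  with that show ?thesis by blast
qed

definition pointed :: "'a::ab_group_add set \<Rightarrow> bool" where
  "pointed C \<longleftrightarrow> (\<forall>x\<in>C. - x \<in> C \<longrightarrow> x = 0)"

text \<open>
  If \<open>f\<close> occurred in the representations of a pair \<open>x, - x\<close>, their sum would put \<open>- f\<close> into the
  old cone. So such a pair already belongs to the old cone.
\<close>

lemma pointed_insert:
  assumes "pointed (isolated_cone F)" and f: "- f \<notin> isolated_cone F"
  shows "pointed (isolated_cone (insert f F))"
  unfolding pointed_def
proof (intro ballI impI)
  fix x assume "x \<in> isolated_cone (insert f F)" "- x \<in> isolated_cone (insert f F)"
  then obtain n m c n' m' c' where
    x: "0 < n" "c \<in> isolated_cone F" "n \<cdot> x = m \<cdot> f + c" and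
    y: "0 < n'" "c' \<in> isolated_cone F" "n' \<cdot> (- x) = m' \<cdot> f + c'"
    by (elim isolated_cone_insertE)
  have "0 = n' \<cdot> n \<cdot> x + n \<cdot> n' \<cdot> (- x)"
    by (simp add: nat_mult_uminus nat_mult_commute[where m = n and n = n'])
  also have "\<dots> = (n' * m + n * m') \<cdot> f + (n' \<cdot> c + n \<cdot> c')"
    unfolding x y by (simp add: sum.distrib nat_mult_mult nat_mult_add_left)
  finally have "(n' * m + n * m') \<cdot> (- f) = n' \<cdot> c + n \<cdot> c'"
    by (simp add: nat_mult_uminus add_eq_0_iff)
  then have "(n' * m + n * m') \<cdot> (- f) \<in> isolated_cone F"
    using x y by (auto intro: isolated_cone.add isolated_cone_nat_mult)
  with f have "n' * m + n * m' = 0"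
    using isolated_cone.root by blast
  with x y have "n \<cdot> x \<in> isolated_cone F" "n' \<cdot> (- x) \<in> isolated_cone F"
    by simp_all
  with x(1) y(1) assms(1) show "x = 0"
    unfolding pointed_def by (blast intro: isolated_cone.root)
qed

section \<open>Extending cones to positive cones\<close>

lemma LO_add: "P \<in> LO \<Longrightarrow> g \<in> P \<Longrightarrow> h \<in> P \<Longrightarrow> g + h \<in> P"
  by (simp add: LO_iff)

lemma LO_zero: "P \<in> LO \<Longrightarrow> 0 \<notin> P"
  unfolding LO_iff by blast

lemma LO_uminus: "P \<in> LO \<Longrightarrow> g \<noteq> 0 \<Longrightarrow> - g \<in> P \<longleftrightarrow> g \<notin> P"
  unfolding LO_iff by blast

lemma isolated_cone_subset_LO:
  assumes "P \<in> LO" "F \<subseteq> P"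
  shows "isolated_cone F \<subseteq> insert 0 P"
proof
  fix x assume "x \<in> isolated_cone F"
  then show "x \<in> insert 0 P"
  proof induction
    case (add x y)
    then show ?case using LO_add[OF assms(1)] by auto
  next
    case (root n x)
    show ?case
    proof (rule ccontr)
      assume "x \<notin> insert 0 P"
      with assms(1) have "- x \<in> P" by (simp add: LO_uminus)
      \<comment> \<open>a positive multiple of the positive element \<open>- x\<close> is positive, but \<open>n \<cdot> x\<close> is not negative\<close>
      have "Suc k \<cdot> (- x) \<in> P" for k
      proof (induction k)
        case (Suc k)
        then show ?case
          using LO_add[OF assms(1) _ \<open>- x \<in> P\<close>] by (simp only: sum.lessThan_Suc[of _ "Suc k"])
      qed (use \<open>- x \<in> P\<close> in simp)
      with root(2) have "- (n \<cdot> x) \<in> P"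
        by (metis Suc_pred nat_mult_uminus)
      with root(3) assms(1) show False
        by (metis LO_uminus LO_zero insert_iff minus_zero)
    qed
  qed (use assms in auto)
qed

lemma pointed_isolated_cone_LO:
  assumes "P \<in> LO" "F \<subseteq> P"
  shows "pointed (isolated_cone F)"
  using isolated_cone_subset_LO[OF assms] LO_uminus[OF assms(1)]
  unfolding pointed_def by (metis insert_iff neg_equal_0_iff_equal subsetD)

text \<open>
  A maximal pointed isolated cone contains \<open>x\<close> or \<open>- x\<close> for every \<open>x\<close>, since otherwise it could be
  enlarged by \<open>pointed_insert\<close>. Removing \<open>0\<close> from it leaves a positive cone.
\<close>

lemma pointed_extends_to_LO:
  assumes "pointed (isolated_cone F)"
  obtains P where "P \<in> LO" "F - {0} \<subseteq> P"
proof -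
  define S where "S = {M. F \<subseteq> M \<and> isolated_cone M = M \<and> pointed M}"
  have "isolated_cone F \<in> S"
    using assms isolated_cone_minimal[of "isolated_cone F" F]
    by (auto simp: S_def intro: isolated_cone.incl)
  moreover have "\<Union>\<C> \<in> S" if "subset.chain S \<C>" "\<C> \<noteq> {}" for \<C>
  proof -
    have CS: "\<C> \<subseteq> S" and ch: "\<And>X Y. X \<in> \<C> \<Longrightarrow> Y \<in> \<C> \<Longrightarrow> X \<subseteq> Y \<or> Y \<subseteq> X"
      using that(1) by (auto simp: subset_chain_def)
    from that(2) obtain M0 where M0: "M0 \<in> \<C>" by blast
    have "x \<in> \<Union>\<C>" if "x \<in> isolated_cone (\<Union>\<C>)" for x
      using that
    proof induction
      case zero
      then show ?case using M0 CS isolated_cone.zero[of M0] by (auto simp: S_def)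
    next
      case (add x y)
      then obtain X Y where "x \<in> X" "X \<in> \<C>" "y \<in> Y" "Y \<in> \<C>" by blast
      with ch[of X Y] obtain Z where "Z \<in> \<C>" "x \<in> Z" "y \<in> Z" by blast
      moreover from this have "isolated_cone Z = Z" using CS by (auto simp: S_def)
      ultimately show ?case using isolated_cone.add[of x Z y] by auto
    next
      case (root n x)
      then obtain X where "n \<cdot> x \<in> X" "X \<in> \<C>" by blast
      moreover from this have "isolated_cone X = X" using CS by (auto simp: S_def)
      ultimately show ?case using isolated_cone.root[where F = X] root(2) by auto
    qed auto
    then have "isolated_cone (\<Union>\<C>) = \<Union>\<C>"
      by (auto intro: isolated_cone.incl)
    moreover have "pointed (\<Union>\<C>)"
      unfolding pointed_def
    proof (intro ballI impI)
      fix x assume "x \<in> \<Union>\<C>" "- x \<in> \<Union>\<C>"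
      then obtain X Y where "x \<in> X" "X \<in> \<C>" "- x \<in> Y" "Y \<in> \<C>" by blast
      with ch[of X Y] obtain Z where "Z \<in> \<C>" "x \<in> Z" "- x \<in> Z" by blast
      then show "x = 0" using CS by (auto simp: S_def pointed_def)
    qed
    moreover have "F \<subseteq> M0" using M0 CS by (auto simp: S_def)
    ultimately show ?thesis using M0 by (auto simp: S_def)
  qed
  ultimately obtain M where M: "M \<in> S" and max: "\<And>X. X \<in> S \<Longrightarrow> M \<subseteq> X \<Longrightarrow> X = M"
    using subset_Zorn_nonempty[of S] by blast
  have MM: "isolated_cone M = M" and pt: "pointed M" and FM: "F \<subseteq> M"
    using M by (auto simp: S_def)
  have total: "x \<in> M" if "- x \<notin> M" for x
  proof -
    have "pointed (isolated_cone (insert x M))"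
      by (rule pointed_insert) (use MM pt that in auto)
    then have "isolated_cone (insert x M) \<in> S"
      using isolated_cone_minimal[of "isolated_cone (insert x M)" "insert x M"] FM
      by (auto simp: S_def intro: isolated_cone.incl)
    with max[of "isolated_cone (insert x M)"] show ?thesis
      by (metis insertCI isolated_cone.incl subset_insertI subset_iff)
  qed
  have "M - {0} \<in> LO"
    unfolding LO_iff
  proof (intro conjI ballI allI)
    fix g h assume gh: "g \<in> M - {0}" "h \<in> M - {0}"
    then have "g + h \<in> M" using isolated_cone.add[of g M h] MM by auto
    moreover have "g + h \<noteq> 0"
      using gh pt by (auto simp: pointed_def add_eq_0_iff)
    ultimately show "g + h \<in> M - {0}" by simp
  next
    fix g
    show "g \<in> M - {0} \<and> - g \<notin> M - {0} \<and> g \<noteq> 0 \<or>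
         g \<notin> M - {0} \<and> - g \<in> M - {0} \<and> g \<noteq> 0 \<or> g \<notin> M - {0} \<and> - g \<notin> M - {0} \<and> g = 0"
      using pt total[of g] total[of "- g"] by (auto simp: pointed_def)
  qed
  with FM that show ?thesis by blast
qed

lemma isolated_cone_empty:
  assumes "torsion_free TYPE('a::ab_group_add)"
  shows "isolated_cone {} = {0::'a}"
proof -
  have "x = 0" if "x \<in> isolated_cone {}" for x :: 'a
    using that by induction (use assms in \<open>auto simp: torsion_free_def\<close>)
  then show ?thesis by (auto intro: isolated_cone.zero)
qed

lemma LO_nonempty:
  assumes "torsion_free TYPE('a::ab_group_add)"
  shows "(LO :: 'a set set) \<noteq> {}"
proof -
  have "pointed (isolated_cone ({}::'a set))"
    by (simp add: isolated_cone_empty assms pointed_def)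
  then show ?thesis by (metis pointed_extends_to_LO empty_iff)
qed

section \<open>Signs undecided by finitely many conditions\<close>

text \<open>
  Commensurability of all elements with a single one; the two signs stand for the integer
  multiples of \<open>f\<close>.
\<close>

definition rank_le_one :: "'a::ab_group_add itself \<Rightarrow> bool" where
  "rank_le_one _ \<longleftrightarrow> (\<exists>f::'a. \<forall>x. \<exists>n m. 0 < n \<and> (n \<cdot> x = m \<cdot> f \<or> n \<cdot> x = - (m \<cdot> f)))"

text \<open>
  If every \<open>x\<close> is commensurable with \<open>f\<close>, then every \<open>x \<otimes> r\<close> is a rational multiple of \<open>f \<otimes> 1\<close>, so
  the tensor product is spanned by one vector.
\<close>

lemma abelian_rank_le_one:
  assumes "rank_le_one TYPE('a::ab_group_add)"
  shows "abelian_rank TYPE('a) \<le> 1"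
proof -
  obtain f :: 'a where f: "\<And>x. \<exists>n m. 0 < n \<and> (n \<cdot> x = m \<cdot> f \<or> n \<cdot> x = - (m \<cdot> f))"
    using assms by (auto simp: rank_le_one_def)
  define e where "e = tensor_of f (1::rat)"
  have scale: "tensor_of (n \<cdot> x) r = rat_scale (of_nat n) (tensor_of x r)" for n r and x :: 'a
  proof (induction n)
    case 0
    have "tensor_of (0::'a) r = 0"
      using tensor_of_add_left[of 0 "0::'a" r] by simp
    then show ?case by (simp del: rat_scale_tensor_of)
  next
    case (Suc n)
    then show ?case
      by (simp add: tensor_of_add_left rat_tensor.scale_left_distrib distrib_right
          tensor_of_add_right)
  qed
  have "tensor_of (0::'a) r = 0" for r
    using tensor_of_add_left[of 0 "0::'a" r] by simp
  then have neg: "tensor_of (- x) r = - tensor_of x r" for r and x :: 'a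
    using tensor_of_add_left[of x "- x" r] by (metis add.right_inverse minus_unique)
  have pure: "tensor_of x r \<in> rat_tensor.span {e}" for x r
  proof -
    obtain n m where n: "0 < n" and nm: "n \<cdot> x = m \<cdot> f \<or> n \<cdot> x = - (m \<cdot> f)"
      using f by blast
    have "tensor_of (m \<cdot> f) r = rat_scale (of_nat m * r) e"
      unfolding scale e_def by simp
    moreover have "rat_scale (of_nat m * r) e \<in> rat_tensor.span {e}"
      by (simp add: rat_tensor.span_scale rat_tensor.span_base)
    ultimately have "tensor_of (n \<cdot> x) r \<in> rat_tensor.span {e}"
      using nm by (metis neg rat_tensor.span_neg)
    then have "rat_scale (1 / of_nat n) (tensor_of (n \<cdot> x) r) \<in> rat_tensor.span {e}"
      by (rule rat_tensor.span_scale)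
    then show ?thesis using n by (simp add: scale)
  qed
  have "t \<in> rat_tensor.span {e}" for t
    by (induction t rule: tensor_induct)
      (auto intro: pure rat_tensor.span_zero rat_tensor.span_diff)
  then have span: "rat_tensor.span {e} = UNIV" by blast
  then have "rat_tensor.dim (UNIV :: ('a, rat) tensor set) \<le> card {e}"
    by (intro rat_tensor.dim_le_card) auto
  moreover have "\<exists>B :: ('a, rat) tensor set. finite B \<and> rat_tensor.span B = UNIV"
    using span by blast
  ultimately show ?thesis
    by (simp add: abelian_rank_def one_enat_def)
qed

text \<open>
  A positive cone in a group of rank greater than one is not finitely generated, even up to roots: of
  two distinct generators the larger one is redundant. The induction over proper subsets implements
  the choice of a minimal generating set.
\<close>

lemma exists_indeterminate_element:
  fixes P :: "'a::ab_group_add set"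
  assumes tf: "torsion_free TYPE('a)" and rk: "\<not> rank_le_one TYPE('a)"
    and P: "P \<in> LO" and F: "finite F" "F \<subseteq> P"
  obtains k :: 'a where "k \<notin> isolated_cone F" "- k \<notin> isolated_cone F"
proof -
  define T where "T G \<longleftrightarrow> G \<subseteq> P \<and> (\<forall>k. k \<in> isolated_cone G \<or> - k \<in> isolated_cone G)" for G
  have "\<not> T G" if "finite G" for G
    using that
  proof (induction G rule: finite_psubset_induct)
    case (psubset G)
    show ?case
    proof
      assume G: "T G"
      have sub: "isolated_cone G \<subseteq> insert 0 P"
        using isolated_cone_subset_LO[OF P] G by (auto simp: T_def)
      have no_two: False if fg: "f \<in> G" "g \<in> G" "f - g \<in> P" for f g
      proof -
        from P \<open>f - g \<in> P\<close> have ne: "f - g \<noteq> 0" "- (f - g) \<notin> insert 0 P"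
          using LO_zero[OF P] LO_uminus[OF P, of "f - g"] by (metis insert_iff neg_equal_0_iff_equal)+
        define H where "H = G - {f}"
        have GH: "G = insert f H" and gH: "g \<in> H"
          using fg ne by (auto simp: H_def)
        have "f - g \<in> isolated_cone (insert f H)"
          using G ne sub GH unfolding T_def by blast
        then obtain n m c where n: "0 < n" and c: "c \<in> isolated_cone H"
          and eq: "n \<cdot> (f - g) = m \<cdot> f + c"
          by (rule isolated_cone_insertE)
        have d: "c + n \<cdot> g \<in> isolated_cone H"
          using c gH by (auto intro: isolated_cone.intros isolated_cone_nat_mult)
        have nf: "n \<cdot> f = m \<cdot> f + (c + n \<cdot> g)"
          using eq by (simp add: sum_subtractf algebra_simps)
        \<comment> \<open>for \<open>m \<ge> n\<close> the equation would write \<open>- g\<close> as a consequence of positive elements\<close>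
        have "m < n"
        proof (rule ccontr)
          assume "\<not> m < n"
          then obtain j where j: "m = n + j" by (metis le_add_diff_inverse not_less)
          have "n \<cdot> g + (j \<cdot> f + c) = 0"
            using nf by (simp add: j nat_mult_add_left algebra_simps)
          then have "- (n \<cdot> g) = j \<cdot> f + c"
            by (rule minus_unique)
          moreover have "j \<cdot> f + c \<in> isolated_cone G"
            using c fg isolated_cone_mono[of H G] GH
            by (blast intro: isolated_cone.intros isolated_cone_nat_mult)
          ultimately have "n \<cdot> (- g) \<in> isolated_cone G" by (simp add: nat_mult_uminus)
          then have "- g \<in> insert 0 P" using sub n isolated_cone.root by blast
          moreover have "g \<in> P" using G fg by (auto simp: T_def)
          ultimately show False
            using LO_uminus[OF P, of g] LO_zero[OF P] by auto
        qed
        then obtain j where j: "n = m + j" "0 < j" by (metis less_imp_add_positive)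
        have "j \<cdot> f = c + n \<cdot> g" using nf by (simp add: j nat_mult_add_left)
        then have "f \<in> isolated_cone H"
          using d j(2) by (metis isolated_cone.root)
        then have "isolated_cone G \<subseteq> isolated_cone H"
          unfolding GH by (intro isolated_cone_minimal) (auto intro: isolated_cone.incl)
        then have "T H"
          using G by (auto simp: T_def H_def)
        moreover have "H \<subset> G" using fg by (auto simp: H_def)
        ultimately show False using psubset.IH by blast
      qed
      have "f = g" if "f \<in> G" "g \<in> G" for f g
        using no_two[of f g] no_two[of g f] that LO_uminus[OF P, of "f - g"] by auto
      then obtain f where f: "G \<subseteq> {f}" by (metis insertCI subsetI subset_empty)
      have one: "\<exists>n m. 0 < n \<and> n \<cdot> x = m \<cdot> f" if "x \<in> isolated_cone G" for x
      proof -
        have "x \<in> isolated_cone {f}" using that isolated_cone_mono[OF f] by blast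
        then obtain n m c where "0 < n" "c \<in> isolated_cone {}" "n \<cdot> x = m \<cdot> f + c"
          by (rule isolated_cone_insertE)
        then show ?thesis by (auto simp: isolated_cone_empty[OF tf])
      qed
      have "\<exists>n m. 0 < n \<and> (n \<cdot> x = m \<cdot> f \<or> n \<cdot> x = - (m \<cdot> f))" for x
      proof (cases "x \<in> isolated_cone G")
        case True
        then show ?thesis using one by blast
      next
        case False
        with G have "- x \<in> isolated_cone G" by (auto simp: T_def)
        from one[OF this] show ?thesis
          unfolding nat_mult_uminus by (metis minus_minus)
      qed
      with rk show False unfolding rank_le_one_def by blast
    qed
  qed
  with F that show ?thesis unfolding T_def by blast
qed

lemma finite_positivity_extends_both_ways:
  fixes P :: "'a::ab_group_add set"
  assumes "torsion_free TYPE('a)" "\<not> rank_le_one TYPE('a)"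
    and P: "P \<in> LO" and F: "finite F" "F \<subseteq> P"
  obtains Q Q' :: "'a set" where "Q \<in> LO" "F \<subseteq> Q" "Q' \<in> LO" "F \<subseteq> Q'" "Q \<noteq> Q'"
proof -
  obtain k where k: "k \<notin> isolated_cone F" "- k \<notin> isolated_cone F"
    using exists_indeterminate_element[OF assms] by blast
  then have "k \<noteq> 0" using isolated_cone.zero by blast
  have "0 \<notin> F" using F LO_zero[OF P] by blast
  have pt: "pointed (isolated_cone F)" using pointed_isolated_cone_LO[OF P F(2)] .
  obtain Q where Q: "Q \<in> LO" "insert k F - {0} \<subseteq> Q"
    using pointed_extends_to_LO[OF pointed_insert[OF pt k(2)]] .
  obtain Q' where Q': "Q' \<in> LO" "insert (- k) F - {0} \<subseteq> Q'"
    using pointed_extends_to_LO[OF pointed_insert[OF pt, of "- k"]] k(1) by auto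
  show ?thesis
  proof (rule that)
    show "Q \<noteq> Q'" using Q Q' \<open>k \<noteq> 0\<close> LO_uminus[of Q k] by auto
  qed (use Q Q' \<open>0 \<notin> F\<close> in auto)
qed

text \<open>
  With \<open>k\<close> of undecided sign, a vanishing combination of \<open>F\<close>, \<open>g + k\<close> and \<open>g - k\<close> must involve the
  last two equally often, as it would decide the sign of \<open>k\<close> otherwise. But then \<open>k\<close> cancels and a
  nontrivial combination of positive elements vanishes. So \<open>g + k\<close> and \<open>g - k\<close> may be taken positive
  together, and \<open>h\<close> is whichever of \<open>k\<close>, \<open>- k\<close> is positive.
\<close>

lemma exists_smaller_positive_element:
  fixes P :: "'a::ab_group_add set"
  assumes "torsion_free TYPE('a)" "\<not> rank_le_one TYPE('a)"
    and P: "P \<in> LO" and F: "finite F" "F \<subseteq> P" and g: "g \<in> F"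
  obtains Q :: "'a set" and h where "Q \<in> LO" "F \<subseteq> Q" "h \<in> Q" "g - h \<in> Q"
proof -
  obtain k where k: "k \<notin> isolated_cone F" "- k \<notin> isolated_cone F"
    using exists_indeterminate_element[OF assms(1-5)] by blast
  have "k \<noteq> 0" using isolated_cone.zero k by blast
  have "0 \<notin> F" using F LO_zero[OF P] by blast
  have gC: "g \<in> isolated_cone F" using g by (rule isolated_cone.incl)
  have pt: "pointed (isolated_cone F)" using pointed_isolated_cone_LO[OF P F(2)] .
  have pt1: "pointed (isolated_cone (insert (g + k) F))"
  proof (rule pointed_insert[OF pt])
    show "- (g + k) \<notin> isolated_cone F"
      using isolated_cone.add[OF gC, of "- (g + k)"] k by auto
  qed
  have "pointed (isolated_cone (insert (g - k) (insert (g + k) F)))"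
  proof (rule pointed_insert[OF pt1], rule notI)
    assume "- (g - k) \<in> isolated_cone (insert (g + k) F)"
    then obtain n m c where n: "0 < n" and c: "c \<in> isolated_cone F"
      and eq: "n \<cdot> (- (g - k)) = m \<cdot> (g + k) + c"
      by (rule isolated_cone_insertE)
    have d: "(n + m) \<cdot> g + c \<in> isolated_cone F"
      using gC c by (intro isolated_cone.add isolated_cone_nat_mult)
    have eq': "n \<cdot> k = m \<cdot> k + ((n + m) \<cdot> g + c)"
      using eq by (simp add: sum_subtractf sum.distrib nat_mult_add_left algebra_simps)
    consider "m = n" | j where "0 < j" "n = m + j" | j where "0 < j" "m = n + j"
      by (metis less_imp_add_positive linorder_neqE_nat)
    then show False
    proof cases
      case 1
      then have "(n + m) \<cdot> g + c = 0" using eq' by simp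
      then have "(n + m) \<cdot> (- g) = c" by (simp add: nat_mult_uminus add_eq_0_iff)
      with n c have "- g \<in> isolated_cone F"
        by (metis isolated_cone.root add_gr_0)
      then have "g = 0" using pt gC by (auto simp: pointed_def)
      with g \<open>0 \<notin> F\<close> show False by blast
    next
      case 2
      then have "j \<cdot> k = (n + m) \<cdot> g + c" using eq' by (simp add: nat_mult_add_left)
      with d \<open>0 < j\<close> k(1) show False by (metis isolated_cone.root)
    next
      case 3
      then have "j \<cdot> k + ((n + m) \<cdot> g + c) = 0"
        using eq' by (simp add: nat_mult_add_left add.assoc)
      then have "j \<cdot> (- k) = (n + m) \<cdot> g + c"
        unfolding nat_mult_uminus by (simp only: add_eq_0_iff minus_minus)
      with d \<open>0 < j\<close> k(2) show False by (metis isolated_cone.root)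
    qed
  qed
  then obtain Q where Q: "Q \<in> LO" "insert (g - k) (insert (g + k) F) - {0} \<subseteq> Q"
    by (rule pointed_extends_to_LO)
  have gk: "g - k \<noteq> 0" "g + k \<noteq> 0"
    using gC k by (auto simp: add_eq_0_iff)
  have FQ: "F \<subseteq> Q" using Q \<open>0 \<notin> F\<close> by blast
  show ?thesis
  proof (cases "k \<in> Q")
    case True
    show ?thesis by (rule that[OF Q(1) FQ True]) (use Q gk in blast)
  next
    case False
    then have "- k \<in> Q" using LO_uminus[OF Q(1) \<open>k \<noteq> 0\<close>] by blast
    then show ?thesis by (rule that[OF Q(1) FQ]) (use Q gk in auto)
  qed
qed


section \<open>Ternary expansions\<close>

definition ternary :: "(nat \<Rightarrow> bool) \<Rightarrow> real" where
  "ternary z = suminf (\<lambda>i. (if z i then 2 else 0) / 3 ^ Suc i)"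

lemma summable_ternary: "summable (\<lambda>i. (if z i then 2 else 0) / 3 ^ Suc i :: real)"
proof (rule summable_comparison_test')
  show "summable (\<lambda>i. (1/3) ^ i :: real)"
    by (simp add: summable_geometric)
  show "norm ((if z i then 2 else 0) / 3 ^ Suc i :: real) \<le> (1/3) ^ i" for i
    by (simp add: field_simps power_divide)
qed

lemma ternary_shift: "ternary z = ((if z 0 then 2 else 0) + ternary (\<lambda>i. z (Suc i))) / 3"
proof -
  have "ternary z = suminf (\<lambda>i. (1/3) * ((if z (Suc i) then 2 else 0) / 3 ^ Suc i)) + (if z 0 then 2 else 0) / 3"
    unfolding ternary_def using suminf_split_head[OF summable_ternary[of z]] by simp
  also have "\<dots> = (1/3) * ternary (\<lambda>i. z (Suc i)) + (if z 0 then 2 else 0) / 3"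
    unfolding ternary_def by (subst suminf_mult[OF summable_ternary]) simp
  finally show ?thesis by simp
qed

lemma ternary_bounds: "0 \<le> ternary z" "ternary z \<le> 1"
proof -
  show "0 \<le> ternary z"
    unfolding ternary_def by (rule suminf_nonneg[OF summable_ternary]) simp
  have g: "(\<lambda>i. (1/3) ^ i :: real) sums (3/2)"
    using geometric_sums[of "1/3 :: real"] by simp
  have "ternary z \<le> suminf (\<lambda>i. (2/3) * (1/3) ^ i)"
    unfolding ternary_def
    by (rule suminf_le[OF _ summable_ternary sums_summable[OF sums_mult[OF g]]])
      (simp add: field_simps power_divide)
  also have "\<dots> = 1"
    using sums_unique[OF sums_mult[OF g, of "2/3"]] by simp
  finally show "ternary z \<le> 1" .
qed

lemma ternary_in_cantor_set: "ternary z \<in> cantor_set"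
proof -
  have "ternary z \<in> cantor_approx n" for n
  proof (induction n arbitrary: z)
    case 0
    then show ?case by (simp add: ternary_bounds)
  next
    case (Suc n)
    then show ?case
      by (subst ternary_shift) (auto simp: add.commute)
  qed
  then show ?thesis by (simp add: cantor_set_def)
qed

text \<open>
  The first digit is determined because \<open>ternary\<close> takes values in \<open>[0, 1/3]\<close> when it is \<open>0\<close> and in
  \<open>[2/3, 1]\<close> when it is \<open>2\<close>.
\<close>

lemma ternary_inj: "ternary y = ternary z \<Longrightarrow> y n = z n"
proof (induction n arbitrary: y z)
  case 0
  then show ?case
    using ternary_shift[of y] ternary_shift[of z] ternary_bounds[of "\<lambda>i. y (Suc i)"]
      ternary_bounds[of "\<lambda>i. z (Suc i)"]
    by (auto split: if_splits)
next
  case (Suc n)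
  have "ternary (\<lambda>i. y (Suc i)) = ternary (\<lambda>i. z (Suc i))"
    using Suc.prems ternary_shift[of y] ternary_shift[of z] ternary_bounds[of "\<lambda>i. y (Suc i)"]
      ternary_bounds[of "\<lambda>i. z (Suc i)"]
    by (auto split: if_splits)
  then show ?case by (rule Suc.IH)
qed

lemma ternary_close: "(\<And>i. i < n \<Longrightarrow> y i = z i) \<Longrightarrow> \<bar>ternary y - ternary z\<bar> \<le> (1/3) ^ n"
proof (induction n arbitrary: y z)
  case 0
  then show ?case using ternary_bounds[of y] ternary_bounds[of z] by simp
next
  case (Suc n)
  have "y 0 = z 0" and "\<bar>ternary (\<lambda>i. y (Suc i)) - ternary (\<lambda>i. z (Suc i))\<bar> \<le> (1/3) ^ n"
    using Suc by auto
  moreover from this have "ternary y - ternary z = (ternary (\<lambda>i. y (Suc i)) - ternary (\<lambda>i. z (Suc i))) / 3"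
    using ternary_shift[of y] ternary_shift[of z] by simp
  ultimately show ?case by (simp add: abs_divide del: eq_divide_eq_numeral1)
qed

text \<open>
  Together with compactness of the image this replaces reading off the digits of a point of the Cantor
  set: each of the intervals forming \<open>cantor_approx n\<close> has length \<open>3 ^ (- n)\<close> and contains a
  ternary expansion.
\<close>

lemma cantor_approx_near_ternary:
  "u \<in> cantor_approx n \<Longrightarrow> \<exists>z. \<bar>u - ternary z\<bar> \<le> (1/3) ^ n"
proof (induction n arbitrary: u)
  case 0
  then show ?case
    using ternary_bounds[of "\<lambda>_. False"] by (intro exI[of _ "\<lambda>_. False"]) auto
next
  case (Suc n)
  then obtain v b where v: "v \<in> cantor_approx n" "u = ((if b then 2 else 0) + v) / 3"
    by (auto simp: add.commute intro: that[of _ True] that[of _ False])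
  from Suc.IH[OF v(1)] obtain z where z: "\<bar>v - ternary z\<bar> \<le> (1/3) ^ n" by blast
  have "ternary (case_nat b z) = ((if b then 2 else 0) + ternary z) / 3"
    by (subst ternary_shift) simp
  then have "\<bar>u - ternary (case_nat b z)\<bar> = \<bar>v - ternary z\<bar> / 3"
    unfolding v by (simp add: field_simps)
  with z show ?case by (intro exI[of _ "case_nat b z"]) simp
qed

section \<open>A characterisation of the Cantor set\<close>

lemma enumerate_cong_initial:
  fixes S T :: "nat set"
  assumes "infinite S" "infinite T" "S \<inter> {..m} = T \<inter> {..m}" "enumerate S i \<le> m"
  shows "enumerate T i = enumerate S i"
  using assms(4)
proof (induction i)
  case 0
  have mem: "n \<in> S \<longleftrightarrow> n \<in> T" if "n \<le> m" for n using assms(3) that by blast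
  show ?case
    unfolding enumerate_0[of T]
  proof (rule Least_equality)
    show "enumerate S 0 \<in> T" using mem 0 enumerate_in_set[OF assms(1)] by blast
    show "enumerate S 0 \<le> t" if "t \<in> T" for t
      using that mem[of t] 0 by (metis Least_le enumerate_0 le_trans nat_le_linear)
  qed
next
  case (Suc i)
  have mem: "n \<in> S \<longleftrightarrow> n \<in> T" if "n \<le> m" for n using assms(3) that by blast
  have less: "enumerate S i < enumerate S (Suc i)" using enumerate_step[OF assms(1)] .
  then have IH: "enumerate T i = enumerate S i" using Suc by simp
  show ?case
    unfolding enumerate_Suc''[OF assms(2)] IH
  proof (rule Least_equality)
    show "enumerate S (Suc i) \<in> T \<and> enumerate S i < enumerate S (Suc i)"
      using mem Suc.prems enumerate_in_set[OF assms(1)] less by blast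
    show "enumerate S (Suc i) \<le> t" if "t \<in> T \<and> enumerate S i < t" for t
      using that mem[of t] Suc.prems
      by (metis (mono_tags, lifting) Least_le enumerate_Suc'' assms(1) le_trans nat_le_linear)
  qed
qed

text \<open>
  The sets \<open>U 0, U 1, \<dots>\<close> give every point an itinerary in a binary tree, but not every branch of the
  tree is inhabited. The set \<open>S x\<close> consists of the levels at which the itinerary of \<open>x\<close> really
  branches. It is infinite, because no point is isolated, and the side that \<open>x\<close> takes at its \<open>i\<close>-th
  branching level is the digit \<open>dig x i\<close>. Forgetting the levels without branching makes every finite
  sequence of digits realisable, which gives a dense image. The digits depend on finitely many \<open>U n\<close>
  each, which gives continuity, and two points first differ at a branching level that has the same
  index for both, which gives injectivity.
\<close>

theorem perfect_clopen_separated_homeomorphic_cantor_set: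
  fixes X :: "'a topology" and U :: "nat \<Rightarrow> 'a set"
  assumes compact: "compact_space X" and ne: "topspace X \<noteq> {}"
    and clopen: "\<And>n. openin X (U n)" "\<And>n. closedin X (U n)"
    and sep: "\<And>x y. x \<in> topspace X \<Longrightarrow> y \<in> topspace X \<Longrightarrow> x \<noteq> y \<Longrightarrow> \<exists>n. (x \<in> U n) \<noteq> (y \<in> U n)"
    and perfect: "\<And>x. x \<in> topspace X \<Longrightarrow> \<not> openin X {x}"
  shows "X homeomorphic_space top_of_set cantor_set"
proof -
  define agree where "agree n x y \<longleftrightarrow> (\<forall>i<n. x \<in> U i \<longleftrightarrow> y \<in> U i)" for n x y
  define cyl where "cyl n x = {y \<in> topspace X. agree n x y}" for n x
  define S where "S x = {n. \<exists>y\<in>topspace X. agree n x y \<and> (x \<in> U n) \<noteq> (y \<in> U n)}" for x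
  define dig where "dig x i \<longleftrightarrow> x \<in> U (enumerate (S x) i)" for x i
  have open_cyl: "openin X (cyl n x)" for n x
  proof (induction n)
    case 0
    have "cyl 0 x = topspace X" by (auto simp: cyl_def agree_def)
    then show ?case by simp
  next
    case (Suc n)
    have "cyl (Suc n) x = cyl n x \<inter> (if x \<in> U n then U n else topspace X - U n)"
      by (auto simp: cyl_def agree_def less_Suc_eq)
    moreover have "openin X (topspace X - U n)" using clopen(2) by blast
    ultimately show ?case using Suc clopen(1)[of n] by auto
  qed
  have first_diff: "\<exists>m. agree m x y \<and> (x \<in> U m) \<noteq> (y \<in> U m)"
    if "x \<in> topspace X" "y \<in> topspace X" "x \<noteq> y" for x y
    unfolding agree_def
    using exists_least_iff[of "\<lambda>m. (x \<in> U m) \<noteq> (y \<in> U m)"] sep[OF that] by blast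
  have inf: "infinite (S x)" if x: "x \<in> topspace X" for x
  proof -
    have "\<exists>m\<ge>n. m \<in> S x" for n
    proof -
      have "x \<in> cyl n x" using x by (simp add: cyl_def agree_def)
      then have "cyl n x \<noteq> {x}" using perfect[OF x] open_cyl[of n x] by auto
      with \<open>x \<in> cyl n x\<close> obtain y where y: "y \<in> cyl n x" "y \<noteq> x" by blast
      then have yX: "y \<in> topspace X" by (simp add: cyl_def)
      from first_diff[OF x yX] y obtain m where m: "agree m x y" "(x \<in> U m) \<noteq> (y \<in> U m)"
        by blast
      moreover have "n \<le> m"
        using y(1) m(2) by (auto simp: cyl_def agree_def intro: leI)
      ultimately show ?thesis using m yX by (auto simp: S_def)
    qed
    then show ?thesis by (simp add: infinite_nat_iff_unbounded_le)
  qed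
  have S_agree: "S x \<inter> {..n} = S y \<inter> {..n}"
    if "x \<in> topspace X" "y \<in> topspace X" "agree n x y" for x y n
  proof -
    have "m \<in> S y" if xy: "x \<in> topspace X" "y \<in> topspace X" "agree n x y" and m: "m \<in> S x" "m \<le> n"
      for x y m
    proof -
      obtain w where w: "w \<in> topspace X" "agree m x w" "(x \<in> U m) \<noteq> (w \<in> U m)"
        using m by (auto simp: S_def)
      have "agree m y x" "agree m y w" using w xy m by (auto simp: agree_def)
      \<comment> \<open>\<open>x\<close> and \<open>w\<close> lie on different sides of \<open>U m\<close>, so one of them is not on the side of \<open>y\<close>\<close>
      with w xy show ?thesis by (auto simp: S_def)
    qed
    moreover have "agree n y x" using that by (auto simp: agree_def)
    ultimately show ?thesis using that by blast
  qed
  have enum_agree: "enumerate (S y) i = enumerate (S x) i"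
    if "x \<in> topspace X" "y \<in> topspace X" "agree n x y" "enumerate (S x) i \<le> n" for x y n i
    using enumerate_cong_initial[OF inf inf S_agree] that by blast
  define g where "g x = ternary (dig x)" for x
  have "continuous_map X euclidean g"
    unfolding mtopology_is_euclidean[symmetric] Met_TC.continuous_map_to_metric
  proof (intro ballI allI impI)
    fix x and \<epsilon> :: real
    assume x: "x \<in> topspace X" and "0 < \<epsilon>"
    obtain n where n: "(1/3) ^ n < \<epsilon>"
      using real_arch_pow_inv[OF \<open>0 < \<epsilon>\<close>, of "1/3"] by auto
    define N where "N = Suc (enumerate (S x) n)"
    have "g y \<in> ball (g x) \<epsilon>" if y: "y \<in> cyl N x" for y
    proof -
      have "dig x i = dig y i" if "i < n" for i
      proof -
        have "enumerate (S x) i < N"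
          using enumerate_mono[OF that inf[OF x]] by (simp add: N_def)
        with x y show ?thesis
          using enum_agree[of x y N i] by (auto simp: cyl_def agree_def dig_def)
      qed
      from ternary_close[of n "dig x" "dig y", OF this] n show ?thesis
        by (simp add: g_def dist_real_def)
    qed
    moreover have "x \<in> cyl N x" using x by (simp add: cyl_def agree_def)
    ultimately show "\<exists>V. openin X V \<and> x \<in> V \<and> (\<forall>y\<in>V. g y \<in> Met_TC.mball (g x) \<epsilon>)"
      using open_cyl by auto
  qed
  then have cont: "continuous_map X (top_of_set cantor_set) g"
    by (auto simp: continuous_map_in_subtopology g_def ternary_in_cantor_set)
  have inj: "inj_on g (topspace X)"
  proof (rule inj_onI, rule ccontr)
    fix x y assume xy: "x \<in> topspace X" "y \<in> topspace X" "g x = g y" "x \<noteq> y"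
    then obtain m where ag: "agree m x y" and m: "(x \<in> U m) \<noteq> (y \<in> U m)"
      using first_diff by blast
    with m xy have "m \<in> S x" by (auto simp: S_def)
    then obtain i where i: "enumerate (S x) i = m"
      using enumerate_Ex inf[OF xy(1)] by blast
    then have "enumerate (S y) i = m" using enum_agree[OF xy(1,2) ag] by simp
    with i m have "dig x i \<noteq> dig y i" by (simp add: dig_def)
    with xy(3) ternary_inj show False by (auto simp: g_def)
  qed
  have realise: "\<exists>x\<in>topspace X. \<forall>i<n. dig x i = z i" for z n
  proof (induction n)
    case (Suc n)
    then obtain x where x: "x \<in> topspace X" "\<And>i. i < n \<Longrightarrow> dig x i = z i" by blast
    show ?case
    proof (cases "dig x n = z n")
      case True
      with x show ?thesis by (auto simp: less_Suc_eq)
    next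
      case False
      let ?m = "enumerate (S x) n"
      have "?m \<in> S x" using enumerate_in_set[OF inf[OF x(1)]] .
      then obtain y where y: "y \<in> topspace X" "agree ?m x y" "(x \<in> U ?m) \<noteq> (y \<in> U ?m)"
        by (auto simp: S_def)
      \<comment> \<open>crossing over at the \<open>n\<close>-th branching level of \<open>x\<close> keeps the earlier digits and flips this one\<close>
      have "dig y i = dig x i" if "i < n" for i
        using enumerate_mono[OF that inf[OF x(1)]] enum_agree[OF x(1) y(1,2), of i] y(2)
        by (auto simp: dig_def agree_def)
      moreover have "dig y n \<noteq> dig x n"
        using enum_agree[OF x(1) y(1,2), of n] y(3) by (auto simp: dig_def)
      ultimately show ?thesis using False x y(1) by (auto simp: less_Suc_eq)
    qed
  qed (use ne in blast)
  \<comment> \<open>the image is dense in the Cantor set, and compact, hence everything\<close>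
  have "cantor_set \<subseteq> closure (g ` topspace X)"
  proof
    fix u assume u: "u \<in> cantor_set"
    show "u \<in> closure (g ` topspace X)"
      unfolding closure_approachable
    proof (intro allI impI)
      fix \<epsilon> :: real assume "0 < \<epsilon>"
      then obtain n where n: "(1/3) ^ n < \<epsilon> / 2"
        using real_arch_pow_inv[of "\<epsilon>/2" "1/3"] by auto
      have "u \<in> cantor_approx n" using u by (simp add: cantor_set_def)
      then obtain z where z: "\<bar>u - ternary z\<bar> \<le> (1/3) ^ n"
        using cantor_approx_near_ternary by blast
      obtain x where x: "x \<in> topspace X" "\<And>i. i < n \<Longrightarrow> dig x i = z i"
        using realise by blast
      have "dist (g x) u < \<epsilon>"
        using ternary_close[of n "dig x" z, OF x(2)] z n by (simp add: g_def dist_real_def)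
      with x(1) show "\<exists>v\<in>g ` topspace X. dist v u < \<epsilon>" by blast
    qed
  qed
  moreover have "compactin euclidean (g ` topspace X)"
    using image_compactin[of X "topspace X" euclidean g] compact \<open>continuous_map X euclidean g\<close>
    by (simp add: compact_space_def)
  then have "closed (g ` topspace X)" by (simp add: compact_imp_closed)
  ultimately have "g ` topspace X = cantor_set"
    using ternary_in_cantor_set by (auto simp: g_def)
  then have "homeomorphic_map X (top_of_set cantor_set) g"
    by (intro continuous_imp_homeomorphic_map compact cont inj)
      (simp_all add: Hausdorff_space_subtopology)
  then show ?thesis by (metis homeomorphic_map_imp_homeomorphic_space)
qed


section \<open>The topology of \<open>LO\<close>\<close>

abbreviation bool_space :: "('a \<Rightarrow> bool) topology" where
  "bool_space \<equiv> product_topology (\<lambda>_. discrete_topology UNIV) UNIV"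

lemma openin_bool_space_coordinate: "openin bool_space {f. f g = b}"
proof -
  have "openin bool_space {f \<in> topspace bool_space. f g \<in> {b}}"
    using continuous_map_product_coordinates[of g UNIV "\<lambda>_. discrete_topology UNIV"]
    by (rule openin_continuous_map_preimage) simp_all
  then show ?thesis by simp
qed

lemma openin_LO_mem: "openin LO_topology {P \<in> LO. g \<in> P}"
  unfolding LO_topology_def openin_pullback_topology
  by (rule exI[of _ "{f. f g = True}"])
    (use openin_bool_space_coordinate[of g True] in auto)

lemma openin_LO_not_mem: "openin LO_topology {P \<in> LO. g \<notin> P}"
  unfolding LO_topology_def openin_pullback_topology
  by (rule exI[of _ "{f. f g = False}"])
    (use openin_bool_space_coordinate[of g False] in auto)

lemma closedin_LO_mem: "closedin LO_topology {P \<in> LO. g \<in> P}"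
proof -
  have "LO - {P \<in> LO. g \<in> P} = {P \<in> LO. g \<notin> P}" by blast
  then show ?thesis by (simp add: closedin_def openin_LO_not_mem)
qed

text \<open>
  Excluding a nonzero element \<open>g\<close> from a positive cone amounts to including \<open>- g\<close>, so neighbourhoods
  can be described by positivity conditions alone.
\<close>

lemma LO_neighbourhood:
  assumes W: "openin LO_topology W" and P: "P \<in> W"
  obtains F where "finite F" "F \<subseteq> P" "\<And>Q. Q \<in> LO \<Longrightarrow> F \<subseteq> Q \<Longrightarrow> Q \<in> W"
proof -
  have PLO: "P \<in> LO" using openin_subset[OF W] P by auto
  obtain V where V: "openin bool_space V" "W = (\<lambda>P g. g \<in> P) -` V \<inter> LO"
    using W unfolding LO_topology_def openin_pullback_topology by blast
  then have "(\<lambda>g. g \<in> P) \<in> V" using P by blast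
  with V(1) obtain X where X: "finite {i. X i \<noteq> UNIV}" "\<And>g. (g \<in> P) \<in> X g" "Pi\<^sub>E UNIV X \<subseteq> V"
    unfolding openin_product_topology_alt by force
  define I where "I = {i. X i \<noteq> UNIV}"
  define F where "F = {g \<in> I. g \<in> P} \<union> uminus ` {g \<in> I. g \<noteq> 0 \<and> g \<notin> P}"
  show ?thesis
  proof (rule that)
    show "finite F" using X(1) by (simp add: F_def I_def)
    show "F \<subseteq> P" using LO_uminus[OF PLO] by (auto simp: F_def)
    fix Q assume Q: "Q \<in> LO" "F \<subseteq> Q"
    have "(g \<in> Q) \<in> X g" for g
    proof (cases "g \<in> I")
      case True
      have "g \<in> Q \<longleftrightarrow> g \<in> P"
      proof (cases "g = 0 \<or> g \<in> P")
        case False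
        then have "- g \<in> Q" using Q True by (auto simp: F_def)
        with False show ?thesis using LO_uminus[OF Q(1)] by blast
      qed (use True Q LO_zero[OF Q(1)] LO_zero[OF PLO] in \<open>auto simp: F_def\<close>)
      with X(2)[of g] show ?thesis by simp
    qed (simp add: I_def)
    with X(3) have "(\<lambda>g. g \<in> Q) \<in> V" by (auto simp: PiE_UNIV_domain)
    with V Q show "Q \<in> W" by blast
  qed
qed

lemma closedin_bool_space_coordinates: "closedin bool_space {f. R (f g) (f h) (f k)}"
proof -
  have "openin bool_space (UNIV - {f. R (f g) (f h) (f k)})"
  proof (subst openin_subopen, intro ballI)
    fix f assume f: "f \<in> UNIV - {f. R (f g) (f h) (f k)}"
    define T where "T = {f'. f' g = f g} \<inter> {f'. f' h = f h} \<inter> {f'. f' k = f k}"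
    have "openin bool_space T"
      unfolding T_def by (intro openin_Int openin_bool_space_coordinate)
    moreover have "f \<in> T" "T \<subseteq> UNIV - {f. R (f g) (f h) (f k)}"
      using f by (auto simp: T_def)
    ultimately show "\<exists>T. openin bool_space T \<and> f \<in> T \<and> T \<subseteq> UNIV - {f. R (f g) (f h) (f k)}"
      by blast
  qed
  then show ?thesis by (simp add: closedin_def)
qed

text \<open>
  Each axiom of a positive cone, for fixed group elements, concerns at most three coordinates.
\<close>

lemma closedin_LO_characteristic_functions:
  "closedin bool_space {f. {g. f g} \<in> (LO :: 'a::group_add set set)}"
proof -
  define A :: "'a \<Rightarrow> 'a \<Rightarrow> ('a \<Rightarrow> bool) set"
    where "A g h = {f. f g \<longrightarrow> f h \<longrightarrow> f (g + h)}" for g h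
  define B :: "'a \<Rightarrow> ('a \<Rightarrow> bool) set"
    where "B g = {f. (f g \<and> \<not> f (- g) \<and> g \<noteq> 0) \<or> (\<not> f g \<and> f (- g) \<and> g \<noteq> 0) \<or>
      (\<not> f g \<and> \<not> f (- g) \<and> g = 0)}" for g
  have "closedin bool_space (A g h)" for g h
    unfolding A_def by (rule closedin_bool_space_coordinates)
  moreover have "closedin bool_space (B g)" for g
    unfolding B_def
    by (rule closedin_bool_space_coordinates[where g = g and h = "- g" and k = g and
        R = "\<lambda>a b _. (a \<and> \<not> b \<and> g \<noteq> 0) \<or> (\<not> a \<and> b \<and> g \<noteq> 0) \<or> (\<not> a \<and> \<not> b \<and> g = 0)"])
  ultimately have "closedin bool_space ((\<Inter>g h. A g h) \<inter> (\<Inter>g. B g))"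
    by (intro closedin_Int closedin_Inter) auto
  moreover have "{f. {g. f g} \<in> (LO :: 'a set set)} = (\<Inter>g h. A g h) \<inter> (\<Inter>g. B g)"
    unfolding LO_iff A_def B_def by blast
  ultimately show ?thesis by simp
qed

lemma compact_space_LO: "compact_space (LO_topology :: 'a::group_add set topology)"
proof -
  let ?K = "{f. {g. f g} \<in> LO} :: ('a \<Rightarrow> bool) set"
  have "compact_space (bool_space :: ('a \<Rightarrow> bool) topology)"
    by (simp add: compact_space_product_topology compact_space_discrete_topology)
  then have "compactin bool_space ?K"
    using closedin_LO_characteristic_functions by (rule closedin_compact_space)
  then have "compact_space (subtopology bool_space ?K)"
    by (simp add: compact_space_subtopology)
  moreover have "continuous_map (subtopology bool_space ?K) LO_topology Collect"
    unfolding LO_topology_def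
    by (rule continuous_map_pullback') (auto simp: o_def)
  ultimately have "compactin LO_topology (Collect ` topspace (subtopology bool_space ?K))"
    unfolding compact_space_def by (rule image_compactin)
  then have "compactin LO_topology (Collect ` ?K)" by simp
  moreover have "Collect ` ?K = LO"
  proof
    show "LO \<subseteq> Collect ` ?K"
    proof
      fix P :: "'a set" assume "P \<in> LO"
      then show "P \<in> Collect ` ?K" by (intro image_eqI[of _ _ "\<lambda>g. g \<in> P"]) simp_all
    qed
  qed auto
  ultimately show ?thesis by (simp add: compact_space_def)
qed

lemma Hausdorff_space_LO: "Hausdorff_space (LO_topology :: 'a::group_add set topology)"
  unfolding Hausdorff_space_def
proof (intro allI impI)
  fix P Q :: "'a set"
  assume "P \<in> topspace LO_topology \<and> Q \<in> topspace LO_topology \<and> P \<noteq> Q"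
  then obtain g where PQ: "P \<in> LO" "Q \<in> LO" and g: "(g \<in> P) \<noteq> (g \<in> Q)" by auto
  let ?A = "{P \<in> LO. g \<in> P}" and ?B = "{P \<in> LO. g \<notin> P}"
  have "openin LO_topology ?A" "openin LO_topology ?B" "disjnt ?A ?B" "disjnt ?B ?A"
    by (auto simp: openin_LO_mem openin_LO_not_mem disjnt_def)
  with PQ g show "\<exists>U V. openin LO_topology U \<and> openin LO_topology V \<and> P \<in> U \<and> Q \<in> V \<and> disjnt U V"
    by (metis (mono_tags, lifting) mem_Collect_eq)
qed

section \<open>Dense orderings\<close>

text \<open>
  By invariance under left translation, density has to be tested only on the intervals from \<open>0\<close> to
  a positive element.
\<close>

lemma dense_LO_iff:
  "P \<in> dense_LO \<longleftrightarrow> P \<in> LO \<and> (\<forall>g\<in>P. \<exists>h\<in>P. - h + g \<in> P)"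
proof
  assume "P \<in> dense_LO"
  then obtain lt where lt: "left_ordering lt" "dense_ordering lt" "P = positive_cone lt"
    by (auto simp: dense_LO_def)
  have "\<exists>h\<in>P. - h + g \<in> P" if "g \<in> P" for g
  proof -
    have "lt 0 g" using that lt by (simp add: positive_cone_def)
    then obtain h where "lt 0 h" "lt h g" using lt(2) by (auto simp: dense_ordering_def)
    with lt show ?thesis by (auto simp: less_iff_in_positive_cone)
  qed
  with lt show "P \<in> LO \<and> (\<forall>g\<in>P. \<exists>h\<in>P. - h + g \<in> P)" by (auto simp: LO_def)
next
  assume P: "P \<in> LO \<and> (\<forall>g\<in>P. \<exists>h\<in>P. - h + g \<in> P)"
  then obtain lt where lt: "left_ordering lt" "P = positive_cone lt"
    by (auto simp: LO_def)
  have "dense_ordering lt"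
    unfolding dense_ordering_def
  proof (intro allI impI)
    fix x y assume "lt x y"
    then have "- x + y \<in> P" using lt by (simp add: less_iff_in_positive_cone)
    then obtain h where h: "h \<in> P" "- h + (- x + y) \<in> P" using P by blast
    moreover have "- x + (x + h) = h" "- (x + h) + y = - h + (- x + y)"
      by (simp, simp only: minus_add add.assoc)
    ultimately have "lt x (x + h) \<and> lt (x + h) y"
      using lt by (simp only: less_iff_in_positive_cone simp_thms)
    then show "\<exists>f. lt x f \<and> lt f y" by blast
  qed
  with lt show "P \<in> dense_LO" by (auto simp: dense_LO_def)
qed

definition not_least :: "'a::group_add \<Rightarrow> 'a set set" where
  "not_least g = {P \<in> LO. g \<in> P \<longrightarrow> (\<exists>h\<in>P. - h + g \<in> P)}"

lemma dense_LO_eq_Inter: "dense_LO = (\<Inter>g. not_least g)"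
  by (auto simp: not_least_def dense_LO_iff)

lemma openin_not_least: "openin LO_topology (not_least g)"
proof -
  have "not_least g = {P \<in> LO. g \<notin> P} \<union> (\<Union>h. {P \<in> LO. h \<in> P} \<inter> {P \<in> LO. - h + g \<in> P})"
    by (auto simp: not_least_def)
  then show ?thesis
    by (auto intro!: openin_Un openin_Union openin_Int openin_LO_mem openin_LO_not_mem)
qed

lemma gdelta_in_dense_LO:
  assumes "countable (UNIV :: 'a::group_add set)"
  shows "gdelta_in LO_topology (dense_LO :: 'a set set)"
  unfolding dense_LO_eq_Inter
  by (rule gdelta_in_Inter)
    (use assms in \<open>auto intro: open_imp_gdelta_in openin_not_least\<close>)

text \<open>
  Near a positive cone \<open>P\<close> that contains \<open>g\<close>, add \<open>g\<close> to the finitely many positivity conditions that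
  define the neighbourhood and create a positive element below \<open>g\<close>. If \<open>g\<close> is not in \<open>P\<close>, then \<open>P\<close>
  itself will do.
\<close>

lemma closure_of_not_least:
  fixes g :: "'a::ab_group_add"
  assumes "torsion_free TYPE('a)" "\<not> rank_le_one TYPE('a)"
  shows "LO_topology closure_of (not_least g) = LO"
proof -
  have "P \<in> LO_topology closure_of (not_least g)" if P: "P \<in> LO" for P
    unfolding in_closure_of
  proof (intro conjI allI impI)
    fix W assume "P \<in> W \<and> openin LO_topology W"
    then obtain F where F: "finite F" "F \<subseteq> P" and FW: "\<And>Q. Q \<in> LO \<Longrightarrow> F \<subseteq> Q \<Longrightarrow> Q \<in> W"
      using LO_neighbourhood by metis
    show "\<exists>Q. Q \<in> not_least g \<and> Q \<in> W"
    proof (cases "g \<in> P")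
      case True
      with F obtain Q h where "Q \<in> LO" "insert g F \<subseteq> Q" "h \<in> Q" "g - h \<in> Q"
        using exists_smaller_positive_element[OF assms P, of "insert g F" g] by auto
      then have "Q \<in> not_least g" "Q \<in> W"
        using FW by (auto simp: not_least_def)
      then show ?thesis by blast
    next
      case False
      then have "P \<in> not_least g" using P by (simp add: not_least_def)
      with FW[OF P F(2)] show ?thesis by blast
    qed
  qed (simp add: P)
  then show ?thesis
    using closure_of_subset_topspace[of LO_topology "not_least g"] by auto
qed

lemma LO_no_isolated_points:
  fixes P :: "'a::ab_group_add set"
  assumes "torsion_free TYPE('a)" "\<not> rank_le_one TYPE('a)" and P: "P \<in> LO"
  shows "\<not> openin LO_topology {P}"
proof
  assume "openin LO_topology {P}"
  then obtain F where F: "finite F" "F \<subseteq> P" "\<And>Q. Q \<in> LO \<Longrightarrow> F \<subseteq> Q \<Longrightarrow> Q \<in> {P}"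
    by (rule LO_neighbourhood) auto
  obtain Q Q' where "Q \<in> LO" "F \<subseteq> Q" "Q' \<in> LO" "F \<subseteq> Q'" "Q \<noteq> Q'"
    using finite_positivity_extends_both_ways[OF assms F(1,2)] .
  with F(3) show False by blast
qed

theorem theorem4p5:
  assumes "countable (UNIV :: 'a::ab_group_add set)"
    and "torsion_free TYPE('a)"
    and "abelian_rank TYPE('a) > 1"
  shows "(LO_topology :: 'a set topology) homeomorphic_space top_of_set cantor_set \<and>
         gdelta_in (LO_topology :: 'a set topology) dense_LO \<and>
         (LO_topology :: 'a set topology) closure_of dense_LO = topspace LO_topology"
proof (intro conjI)
  have rank: "\<not> rank_le_one TYPE('a)"
    using abelian_rank_le_one assms(3) by (auto simp: not_le[symmetric])
  let ?a = "from_nat_into (UNIV :: 'a set)"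
  show "(LO_topology :: 'a set topology) homeomorphic_space top_of_set cantor_set"
  proof (rule perfect_clopen_separated_homeomorphic_cantor_set[where U = "\<lambda>n. {P \<in> LO. ?a n \<in> P}"])
    fix P Q :: "'a set"
    assume PQ: "P \<in> topspace LO_topology" "Q \<in> topspace LO_topology" "P \<noteq> Q"
    then obtain g where g: "(g \<in> P) \<noteq> (g \<in> Q)" by blast
    obtain n where "?a n = g" using from_nat_into_surj[OF assms(1)] by blast
    with g PQ show "\<exists>n. (P \<in> {P \<in> LO. ?a n \<in> P}) \<noteq> (Q \<in> {P \<in> LO. ?a n \<in> P})" by auto
  qed (use LO_no_isolated_points[OF assms(2) rank] LO_nonempty[OF assms(2)] in
      \<open>simp_all add: compact_space_LO openin_LO_mem closedin_LO_mem\<close>)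
  show "gdelta_in (LO_topology :: 'a set topology) dense_LO"
    using assms(1) by (rule gdelta_in_dense_LO)
  show "(LO_topology :: 'a set topology) closure_of dense_LO = topspace LO_topology"
    unfolding dense_LO_eq_Inter
  proof (rule Baire_category)
    show "completely_metrizable_space (LO_topology :: 'a set topology) \<or>
      locally_compact_space (LO_topology :: 'a set topology) \<and> regular_space (LO_topology :: 'a set topology)"
      by (simp add: compact_imp_locally_compact_space compact_Hausdorff_imp_regular_space
          compact_space_LO Hausdorff_space_LO)
  qed (use assms(1) closure_of_not_least[OF assms(2) rank] in \<open>auto simp: openin_not_least\<close>)
qed

end
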